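(* For every $1<p<\infty$, $$|||K|||_{\ell^p}=|||T_{\frac12}|||_{\ell^p}.$$
   Context: For $1\le p<\infty$, $\ell^p$ is the space of complex-valued sequences $\vec a=(a_j)_{j\in\mathbb{Z}}$ with $\|\vec a\|_{\ell^p}=(\sum_{j\in\mathbb{Z}}|a_j|^p)^{1/p}<\infty$, and $|||L|||_{\ell^p}$ denotes the $\ell^p\to\ell^p$ operator norm of $L$. The Kak-Hilbert transform $K$ is $$K(\vec a)_k=\begin{cases}\displaystyle\frac2\pi\sum_{n\text{ even}}\frac{a_n}{k-n} & k\text{ odd},\\[2mm] \displaystyle\frac2\pi\sum_{n\text{ odd}}\frac{a_n}{k-n} & k\text{ even},\end{cases}\qquad k\in\mathbb{Z},$$ and $T_{\frac12}$ is the operator $$(T_{\frac12}(\vec a))_m=\frac1\pi\sum_{n\in\mathbb{Z}}\frac{a_n}{m-n+\frac12},\qquad m\in\mathbb{Z}.$$ It is known that $T_{\frac12}$ is bounded on $\ell^p$ for $1<p<\infty$. *)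

theory Defs
  imports "HOL-Analysis.Analysis"
begin

definition lp_space :: "real \<Rightarrow> (int \<Rightarrow> complex) set" where
  "lp_space p = {a. (\<lambda>j. cmod (a j) powr p) summable_on UNIV}"

definition lp_norm :: "real \<Rightarrow> (int \<Rightarrow> complex) \<Rightarrow> real" where
  "lp_norm p a = (\<Sum>\<^sub>\<infinity>j. cmod (a j) powr p) powr (1 / p)"

text \<open>The norm with value \<open>\<infinity>\<close> outside \<open>lp_space p\<close>; the real-valued \<open>lp_norm\<close> is \<open>0\<close> there.\<close>

definition lp_enorm :: "real \<Rightarrow> (int \<Rightarrow> complex) \<Rightarrow> ennreal" where
  "lp_enorm p a = (if a \<in> lp_space p then ennreal (lp_norm p a) else \<infinity>)"

text \<open>
  The operator norm takes values in \<open>[0, \<infinity>]\<close>: it is \<open>\<infinity>\<close> if \<open>L\<close> is unbounded on, or does not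
  preserve, \<open>lp_space p\<close>, so that no junk value of a real supremum can arise.
\<close>

definition lp_opnorm :: "real \<Rightarrow> ((int \<Rightarrow> complex) \<Rightarrow> (int \<Rightarrow> complex)) \<Rightarrow> ennreal" where
  "lp_opnorm p L = (SUP a \<in> {a \<in> lp_space p. lp_norm p a \<le> 1}. lp_enorm p (L a))"

text \<open>
  For \<open>a \<in> lp_space p\<close> with \<open>1 < p < \<infinity>\<close> the series below converge absolutely by Hoelder's
  inequality, so the unordered sums are the usual ones.
\<close>

definition Kak_Hilbert :: "(int \<Rightarrow> complex) \<Rightarrow> int \<Rightarrow> complex" where
  "Kak_Hilbert a k =
     (if odd k
      then of_real (2 / pi) * (\<Sum>\<^sub>\<infinity>n\<in>{n. even n}. a n / of_int (k - n))
      else of_real (2 / pi) * (\<Sum>\<^sub>\<infinity>n\<in>{n. odd n}. a n / of_int (k - n)))"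

definition T_half :: "(int \<Rightarrow> complex) \<Rightarrow> int \<Rightarrow> complex" where
  "T_half a m = of_real (1 / pi) * (\<Sum>\<^sub>\<infinity>n. a n / (of_int (m - n) + 1 / 2))"

end

theory Submission
  imports Defs
begin

text \<open>
  Up to the isometric splitting of a sequence into its subsequences on the even and on the odd
  integers, \<open>Kak_Hilbert\<close> is the direct sum of two copies of \<open>T_half\<close>: with \<open>b\<^sub>n = a\<^sub>2\<^sub>n\<close> and
  \<open>c\<^sub>n = a\<^sub>2\<^sub>n\<^sub>-\<^sub>1\<close>, dividing the denominators \<open>2 * m + 1 - 2 * n\<close> and \<open>2 * m - (2 * n - 1)\<close> by
  two shows that the transform of \<open>a\<close> is \<open>T_half b\<close> on the odd integers \<open>2 * m + 1\<close> and
  \<open>T_half c\<close> on the even integers \<open>2 * m\<close> (\<open>Kak_Hilbert_odd\<close>, \<open>Kak_Hilbert_even\<close>). The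
  \<open>p\<close>-th power of the \<open>\<ell>\<^sup>p\<close> norm is additive under the splitting (\<open>lp_parity_split\<close>), and the norm
  of an \<open>\<ell>\<^sup>p\<close> direct sum of operators is the larger of their norms; here both are the norm of
  \<open>T_half\<close>.

  Both norms are elements of \<open>[0, \<infinity>]\<close>. One inequality comes from applying the Kak-Hilbert
  transform to sequences supported on the even integers; the other is trivial if the norm of
  \<open>T_half\<close> is infinite, and otherwise follows by adding the estimates for \<open>T_half b\<close> and
  \<open>T_half c\<close>, which amount to a bound by the norm of \<open>a\<close>.
\<close>

section \<open>Powers of the norm and homogeneous operators\<close>

definition lp_mass :: "real \<Rightarrow> (int \<Rightarrow> complex) \<Rightarrow> real" where
  "lp_mass p a = (\<Sum>\<^sub>\<infinity>j. cmod (a j) powr p)"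

lemma lp_mass_nonneg: "0 \<le> lp_mass p a"
  unfolding lp_mass_def by (intro infsum_nonneg) auto

lemma lp_norm_eq_mass: "lp_norm p a = lp_mass p a powr (1 / p)"
  by (simp add: lp_norm_def lp_mass_def)

lemma lp_norm_le_iff_mass_le:
  assumes "0 < p" "0 \<le> r"
  shows "lp_norm p a \<le> r \<longleftrightarrow> lp_mass p a \<le> r powr p"
proof
  assume "lp_norm p a \<le> r"
  then have "lp_norm p a powr p \<le> r powr p"
    using assms by (intro powr_mono2) (auto simp: lp_norm_eq_mass)
  then show "lp_mass p a \<le> r powr p"
    using assms lp_mass_nonneg[of p a] by (simp add: lp_norm_eq_mass powr_powr)
next
  assume "lp_mass p a \<le> r powr p"
  then have "lp_mass p a powr (1 / p) \<le> (r powr p) powr (1 / p)"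
    using assms lp_mass_nonneg[of p a] by (intro powr_mono2) auto
  then show "lp_norm p a \<le> r"
    using assms by (simp add: lp_norm_eq_mass powr_powr)
qed

lemma lp_enorm_le_ennreal_iff:
  assumes "0 < p" "0 \<le> r"
  shows "lp_enorm p a \<le> ennreal r \<longleftrightarrow> a \<in> lp_space p \<and> lp_mass p a \<le> r powr p"
  using assms lp_norm_le_iff_mass_le[OF assms, of a]
  by (auto simp: lp_enorm_def top_unique)

lemma lp_enorm_cong_mass:
  assumes "a \<in> lp_space p \<longleftrightarrow> b \<in> lp_space p" "lp_mass p a = lp_mass p b"
  shows "lp_enorm p a = lp_enorm p b"
  using assms by (simp add: lp_enorm_def lp_norm_eq_mass)

lemma lp_mass_scale:
  "lp_mass p (\<lambda>n. of_real s * a n) = \<bar>s\<bar> powr p * lp_mass p a"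
  unfolding lp_mass_def by (simp add: norm_mult powr_mult infsum_cmult_right')

lemma lp_space_scale:
  assumes "a \<in> lp_space p"
  shows "(\<lambda>n. of_real s * a n) \<in> lp_space p"
  using assms unfolding lp_space_def
  by (simp add: norm_mult powr_mult summable_on_cmult_right)

lemma lp_mass_eq_0_imp:
  assumes "a \<in> lp_space p" "lp_mass p a = 0"
  shows "a = (\<lambda>n. 0)"
proof
  fix n
  have "cmod (a n) powr p = 0"
    using nonneg_infsum_le_0D[of "\<lambda>j. cmod (a j) powr p" UNIV n] assms
    by (simp add: lp_space_def lp_mass_def)
  then show "a n = 0" by simp
qed

lemma zero_in_lp_space: "(\<lambda>n. 0) \<in> lp_space p"
  by (simp add: lp_space_def)

lemma lp_mass_zero: "lp_mass p (\<lambda>n. 0) = 0"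
  by (simp add: lp_mass_def)

text \<open>
  For an operator commuting with real scalars, a bound on the unit ball extends to the whole
  space by normalising. Taking \<open>s = 0\<close> in the homogeneity hypothesis gives the case of the zero
  sequence, which cannot be normalised.
\<close>

lemma lp_mass_le_of_opnorm:
  assumes p: "0 < p" and r: "0 \<le> r"
    and homogeneous: "\<And>s a. L (\<lambda>n. of_real s * a n) = (\<lambda>n. of_real s * L a n)"
    and bound: "lp_opnorm p L \<le> ennreal r" and a: "a \<in> lp_space p"
  shows "L a \<in> lp_space p \<and> lp_mass p (L a) \<le> r powr p * lp_mass p a"
proof (cases "lp_mass p a = 0")
  case True
  then have "a = (\<lambda>n. 0)" using lp_mass_eq_0_imp a by blast
  moreover have "L (\<lambda>n. 0) = (\<lambda>n. 0)" using homogeneous[of 0 a] by simp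
  ultimately show ?thesis by (simp add: zero_in_lp_space lp_mass_zero)
next
  case False
  define t where "t = lp_norm p a"
  have t: "0 < t" "t powr p = lp_mass p a"
    using False p lp_mass_nonneg[of p a] by (auto simp: t_def lp_norm_eq_mass powr_powr)
  define u where "u = (\<lambda>n. of_real (1 / t) * a n)"
  have u: "u \<in> lp_space p" unfolding u_def by (rule lp_space_scale[OF a])
  have "lp_mass p u = 1"
    using t False unfolding u_def lp_mass_scale by (simp add: powr_divide)
  then have "lp_norm p u \<le> 1" by (simp add: lp_norm_eq_mass)
  then have "lp_enorm p (L u) \<le> lp_opnorm p L"
    unfolding lp_opnorm_def using u by (intro SUP_upper) auto
  then have Lu: "L u \<in> lp_space p" "lp_mass p (L u) \<le> r powr p"
    using lp_enorm_le_ennreal_iff[OF p r] bound order_trans by blast+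
  have "a = (\<lambda>n. of_real t * u n)" using t by (simp add: u_def)
  then have La: "L a = (\<lambda>n. of_real t * L u n)" using homogeneous by metis
  have "lp_mass p (L a) = t powr p * lp_mass p (L u)"
    using t unfolding La lp_mass_scale by simp
  also have "\<dots> \<le> lp_mass p a * r powr p"
    using Lu t lp_mass_nonneg[of p a] by (simp add: mult_left_mono)
  finally show ?thesis
    using lp_space_scale[OF Lu(1), of t] by (simp add: La mult.commute)
qed

section \<open>Splitting a sequence by parity\<close>

lemma inj_double_plus: "inj_on (\<lambda>n::int. 2 * n + d) A"
  by (auto intro: inj_onI)

lemma range_double: "range (\<lambda>n::int. 2 * n) = {n. even n}"
  by (auto elim: evenE)

lemma range_double_plus_odd:
  assumes "odd (d::int)"
  shows "range (\<lambda>n. 2 * n + d) = {n. odd n}"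
proof -
  have "k \<in> range (\<lambda>n. 2 * n + d)" if "odd k" for k
  proof -
    have "even (k - d)" using that assms by simp
    then obtain n where "k - d = 2 * n" by (elim evenE)
    then have "k = 2 * n + d" by simp
    then show ?thesis by blast
  qed
  then show ?thesis using assms by auto
qed

lemma infsum_evens:
  "(\<Sum>\<^sub>\<infinity>k\<in>{k::int. even k}. f k) = (\<Sum>\<^sub>\<infinity>n. f (2 * n))"
  using infsum_reindex[OF inj_double_plus[of 0 UNIV], of f]
  by (simp add: range_double o_def)

lemma infsum_odds:
  assumes "odd (d::int)"
  shows "(\<Sum>\<^sub>\<infinity>k\<in>{k. odd k}. f k) = (\<Sum>\<^sub>\<infinity>n. f (2 * n + d))"
  using infsum_reindex[OF inj_double_plus[of d UNIV], of f]
  by (simp add: range_double_plus_odd[OF assms] o_def)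

lemma summable_on_evens:
  "f summable_on {k::int. even k} \<longleftrightarrow> (\<lambda>n. f (2 * n)) summable_on UNIV"
  using summable_on_reindex[OF inj_double_plus[of 0 UNIV], of f]
  by (simp add: range_double o_def)

lemma summable_on_odds:
  assumes "odd (d::int)"
  shows "f summable_on {k. odd k} \<longleftrightarrow> (\<lambda>n. f (2 * n + d)) summable_on UNIV"
  using summable_on_reindex[OF inj_double_plus[of d UNIV], of f]
  by (simp add: range_double_plus_odd[OF assms] o_def)

text \<open>
  The offset \<open>d\<close> enumerating the odd integers is left free because the input of the transform is
  enumerated by \<open>2 * n - 1\<close> and its output by \<open>2 * n + 1\<close>.
\<close>

lemma lp_parity_split:
  assumes d: "odd d"
  shows lp_space_parity_iff:
      "a \<in> lp_space p \<longleftrightarrow> (\<lambda>n. a (2 * n)) \<in> lp_space p \<and> (\<lambda>n. a (2 * n + d)) \<in> lp_space p"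
    and lp_mass_parity:
      "a \<in> lp_space p \<Longrightarrow>
         lp_mass p a = lp_mass p (\<lambda>n. a (2 * n)) + lp_mass p (\<lambda>n. a (2 * n + d))"
proof -
  let ?f = "\<lambda>j. cmod (a j) powr p"
  have cover: "{k. even k} \<union> {k. odd k} = (UNIV :: int set)" by auto
  have disjoint: "{k::int. even k} \<inter> {k. odd k} = {}" by auto
  have restrict: "?f summable_on A" if "a \<in> lp_space p" for A
    using that summable_on_subset_banach[of ?f UNIV A] by (simp add: lp_space_def)
  have join: "?f summable_on UNIV" if "?f summable_on {k. even k}" "?f summable_on {k. odd k}"
    using summable_on_Un_disjoint[OF that disjoint] cover by simp
  show "a \<in> lp_space p \<longleftrightarrow> (\<lambda>n. a (2 * n)) \<in> lp_space p \<and> (\<lambda>n. a (2 * n + d)) \<in> lp_space p"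
    using restrict[of "{k. even k}"] restrict[of "{k. odd k}"] join
    unfolding summable_on_evens[of ?f] summable_on_odds[OF d, of ?f]
    by (auto simp: lp_space_def)
  show "lp_mass p a = lp_mass p (\<lambda>n. a (2 * n)) + lp_mass p (\<lambda>n. a (2 * n + d))"
    if "a \<in> lp_space p"
    using infsum_Un_disjoint[OF restrict restrict disjoint, OF that that]
    unfolding cover infsum_evens infsum_odds[OF d]
    by (simp add: lp_mass_def)
qed

section \<open>The two components of the transform\<close>

lemma T_half_scale: "T_half (\<lambda>n. of_real s * a n) = (\<lambda>n. of_real s * T_half a n)"
proof
  fix m
  have "T_half (\<lambda>n. of_real s * a n) m =
      of_real (1 / pi) * (\<Sum>\<^sub>\<infinity>n. of_real s * (a n / (of_int (m - n) + 1 / 2)))"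
    unfolding T_half_def by (simp only: times_divide_eq_right)
  then show "T_half (\<lambda>n. of_real s * a n) m = of_real s * T_half a m"
    unfolding infsum_cmult_right' T_half_def by (simp only: mult.left_commute)
qed

lemma halve_denominator:
  "of_real (2 / pi) * (\<Sum>\<^sub>\<infinity>n. b n / of_int (2 * (m - n) + 1)) = T_half b m"
proof -
  have "b n / (of_int (m - n) + 1 / 2) = 2 * (b n / of_int (2 * (m - n) + 1))" for n
  proof -
    have "of_int (m - n) + 1 / 2 = (of_int (2 * (m - n) + 1) / 2 :: complex)"
      by (simp add: field_simps)
    then show ?thesis by (simp only: divide_divide_eq_right) simp
  qed
  then show ?thesis
    unfolding T_half_def by (simp only: infsum_cmult_right') simp
qed

lemma Kak_Hilbert_odd: "Kak_Hilbert a (2 * m + 1) = T_half (\<lambda>n. a (2 * n)) m"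
proof -
  have "2 * m + 1 - 2 * n = 2 * (m - n) + 1" for n by simp
  moreover have "odd (2 * m + 1)" by simp
  ultimately show ?thesis
    unfolding halve_denominator[symmetric] Kak_Hilbert_def infsum_evens by (simp only: if_True not_False_eq_True)
qed

lemma Kak_Hilbert_even: "Kak_Hilbert a (2 * m) = T_half (\<lambda>n. a (2 * n - 1)) m"
proof -
  have "2 * m - (2 * n + - 1) = 2 * (m - n) + 1" for n by simp
  moreover have "\<not> odd (2 * m)" "odd (- 1 :: int)" by simp_all
  ultimately show ?thesis
    unfolding halve_denominator[symmetric] Kak_Hilbert_def infsum_odds[OF \<open>odd (- 1)\<close>]
    by (simp only: if_False add_uminus_conv_diff)
qed

section \<open>Comparison of the operator norms\<close>

text \<open>
  Sequences supported on the even integers recover \<open>T_half\<close>: the odd half of the input vanishes,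
  hence so does the even half of the output.
\<close>

lemma opnorm_T_half_le_opnorm_Kak_Hilbert:
  "lp_opnorm p T_half \<le> lp_opnorm p Kak_Hilbert"
  unfolding lp_opnorm_def
proof (rule SUP_mono)
  fix a assume "a \<in> {a \<in> lp_space p. lp_norm p a \<le> 1}"
  then have a: "a \<in> lp_space p" "lp_norm p a \<le> 1" by auto
  define A where "A = (\<lambda>k. if even k then a (k div 2) else 0)"
  have halves: "(\<lambda>n. A (2 * n)) = a" "(\<lambda>n. A (2 * n + 1)) = (\<lambda>n. 0)"
      "(\<lambda>n. A (2 * n - 1)) = (\<lambda>n. 0)"
    by (auto simp: A_def)
  have A: "A \<in> lp_space p"
    using a lp_space_parity_iff[of 1 A p] by (simp add: halves zero_in_lp_space)
  moreover have "lp_mass p A = lp_mass p a"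
    using lp_mass_parity[OF _ A, of 1] by (simp add: halves lp_mass_zero)
  ultimately have "A \<in> {a \<in> lp_space p. lp_norm p a \<le> 1}"
    using a by (simp add: lp_norm_eq_mass)
  moreover have "lp_enorm p (T_half a) = lp_enorm p (Kak_Hilbert A)"
  proof -
    have "T_half (\<lambda>n. 0) = (\<lambda>n. 0)" using T_half_scale[of 0 a] by simp
    then have KA: "(\<lambda>m. Kak_Hilbert A (2 * m)) = (\<lambda>m. 0)"
        "(\<lambda>m. Kak_Hilbert A (2 * m + 1)) = T_half a"
      unfolding Kak_Hilbert_even Kak_Hilbert_odd by (simp_all add: halves)
    have mem: "Kak_Hilbert A \<in> lp_space p \<longleftrightarrow> T_half a \<in> lp_space p"
      using lp_space_parity_iff[of 1 "Kak_Hilbert A" p] by (simp add: KA zero_in_lp_space)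
    show ?thesis
    proof (cases "T_half a \<in> lp_space p")
      case True
      with mem have "Kak_Hilbert A \<in> lp_space p" by simp
      from lp_mass_parity[OF _ this, of 1] show ?thesis
        using mem by (intro lp_enorm_cong_mass) (simp_all add: KA lp_mass_zero)
    next
      case False
      with mem show ?thesis by (simp add: lp_enorm_def)
    qed
  qed
  ultimately show "\<exists>b\<in>{a \<in> lp_space p. lp_norm p a \<le> 1}.
      lp_enorm p (T_half a) \<le> lp_enorm p (Kak_Hilbert b)"
    by (intro bexI[of _ A]) simp_all
qed

text \<open>
  If \<open>r\<close> bounds \<open>T_half\<close>, both halves of the output are bounded by \<open>r\<close> times a half of the input,
  and the \<open>p\<close>-th powers of these two estimates add up.
\<close>

lemma opnorm_Kak_Hilbert_le_opnorm_T_half: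
  assumes p: "0 < p"
  shows "lp_opnorm p Kak_Hilbert \<le> lp_opnorm p T_half"
proof (cases "lp_opnorm p T_half")
  case (real r)
  have "lp_enorm p (Kak_Hilbert a) \<le> ennreal r"
    if a: "a \<in> lp_space p" "lp_norm p a \<le> 1" for a
  proof -
    let ?b = "\<lambda>n. a (2 * n)" and ?c = "\<lambda>n. a (2 * n - 1)"
    let ?K = "Kak_Hilbert a"
    have bc: "?b \<in> lp_space p" "?c \<in> lp_space p"
      using a lp_space_parity_iff[of "-1" a p] by simp_all
    note T_bound = lp_mass_le_of_opnorm[OF p \<open>0 \<le> r\<close> T_half_scale eq_refl[OF real(2)]]
    note Tb = T_bound[OF bc(1)] and Tc = T_bound[OF bc(2)]
    have mem: "?K \<in> lp_space p"
      using Tb Tc by (simp add: lp_space_parity_iff[of 1 ?K] Kak_Hilbert_even Kak_Hilbert_odd)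
    have "lp_mass p ?K = lp_mass p (T_half ?c) + lp_mass p (T_half ?b)"
      using lp_mass_parity[OF _ mem, of 1] by (simp add: Kak_Hilbert_even Kak_Hilbert_odd)
    also have "\<dots> \<le> r powr p * (lp_mass p ?b + lp_mass p ?c)"
      using Tb Tc by (simp add: distrib_left)
    also have "\<dots> = r powr p * lp_mass p a"
      using lp_mass_parity[OF _ a(1), of "-1"] by simp
    also have "\<dots> \<le> r powr p"
      using a(2) p by (simp add: lp_norm_le_iff_mass_le mult_left_le)
    finally show ?thesis
      using mem p \<open>0 \<le> r\<close> by (simp add: lp_enorm_le_ennreal_iff)
  qed
  then show ?thesis
    unfolding real(2) lp_opnorm_def[of p Kak_Hilbert] by (auto intro: SUP_least)
next
  case top
  then show ?thesis by simp
qed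

theorem theorem3p1:
  fixes p :: real
  assumes "1 < p"
  shows "lp_opnorm p Kak_Hilbert = lp_opnorm p T_half"
  using assms
  by (intro antisym opnorm_Kak_Hilbert_le_opnorm_T_half opnorm_T_half_le_opnorm_Kak_Hilbert) simp

end
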